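(* For every integer $n\geq 3$, there exists a graph $G$ of order $n$ with $\chi_d^{tt}(G)=n$.
   Context: All graphs are finite, simple and undirected. For a graph $G=(V,E)$ call the elements of $V\cup E$ objects; two vertices are adjacent if joined by an edge, two edges are adjacent if they share an endpoint, and a vertex and an edge are incident if the vertex is an endpoint of the edge. A total coloring of $G$ assigns a color to every object so that any two adjacent or incident objects receive different colors; a color class is the set of all objects of one color. A total dominator total coloring of a graph $G$ with positive minimum degree is a total coloring of $G$ in which every object of $G$ is adjacent or incident to every object of some color class. The total dominator total chromatic number $\chi_d^{tt}(G)$ is the minimum number of color classes in a total dominator total coloring of $G$. *)

theory Defs
  imports Main
begin

(* A graph is given by its vertex set and its set of edges, where the edge
   joining u and v is the two-element set {u, v}. *)
definition simple_graph :: "'a set \<Rightarrow> 'a set set \<Rightarrow> bool" where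
  "simple_graph V E \<longleftrightarrow> finite V \<and> (\<forall>e\<in>E. e \<subseteq> V \<and> card e = 2)"

definition degree :: "'a set set \<Rightarrow> 'a \<Rightarrow> nat" where
  "degree E v = card {e \<in> E. v \<in> e}"

(* Only meaningful for finite nonempty V. *)
definition min_degree :: "'a set \<Rightarrow> 'a set set \<Rightarrow> nat" where
  "min_degree V E = Min (degree E ` V)"

definition objects :: "'a set \<Rightarrow> 'a set set \<Rightarrow> ('a + 'a set) set" where
  "objects V E = V <+> E"

(* In a simple graph no object is related to itself: {u, u} has one element,
   hence is not an edge, and adjacent edges are required to be distinct. *)
fun adj_or_inc :: "'a set set \<Rightarrow> 'a + 'a set \<Rightarrow> 'a + 'a set \<Rightarrow> bool" where
  "adj_or_inc E (Inl u) (Inl v) \<longleftrightarrow> {u, v} \<in> E"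
| "adj_or_inc E (Inr e) (Inr f) \<longleftrightarrow> e \<noteq> f \<and> e \<inter> f \<noteq> {}"
| "adj_or_inc E (Inl u) (Inr e) \<longleftrightarrow> u \<in> e"
| "adj_or_inc E (Inr e) (Inl u) \<longleftrightarrow> u \<in> e"

(* Colors are natural numbers; no generality is lost as graphs are finite. *)
definition total_coloring :: "'a set \<Rightarrow> 'a set set \<Rightarrow> ('a + 'a set \<Rightarrow> nat) \<Rightarrow> bool" where
  "total_coloring V E c \<longleftrightarrow>
     (\<forall>x\<in>objects V E. \<forall>y\<in>objects V E. adj_or_inc E x y \<longrightarrow> c x \<noteq> c y)"

(* Only colors that are actually used contribute, so color classes are nonempty. *)
definition color_classes ::
    "'a set \<Rightarrow> 'a set set \<Rightarrow> ('a + 'a set \<Rightarrow> nat) \<Rightarrow> ('a + 'a set) set set" where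
  "color_classes V E c = (\<lambda>i. {x \<in> objects V E. c x = i}) ` (c ` objects V E)"

definition total_dominator_total_coloring ::
    "'a set \<Rightarrow> 'a set set \<Rightarrow> ('a + 'a set \<Rightarrow> nat) \<Rightarrow> bool" where
  "total_dominator_total_coloring V E c \<longleftrightarrow> total_coloring V E c \<and>
     (\<forall>x\<in>objects V E. \<exists>C\<in>color_classes V E c. \<forall>y\<in>C. adj_or_inc E x y)"

(* The minimum is over a nonempty set when the minimum degree is positive, see
   total_dominator_total_coloring_exists below; otherwise the value is unspecified. *)
definition tdt_chromatic_number :: "'a set \<Rightarrow> 'a set set \<Rightarrow> nat" where
  "tdt_chromatic_number V E =
     (LEAST k. \<exists>c. total_dominator_total_coloring V E c \<and> card (color_classes V E c) = k)"

lemma total_dominator_total_coloring_exists: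
  assumes G: "simple_graph V E" and V: "V \<noteq> {}" and pos: "min_degree V E > 0"
  shows "\<exists>c. total_dominator_total_coloring V E c"
proof -
  have finV: "finite V" using G by (simp add: simple_graph_def)
  have "E \<subseteq> Pow V" using G by (auto simp: simple_graph_def)
  then have "finite E" using finV by (simp add: finite_subset)
  then have "finite (objects V E)" using finV by (simp add: objects_def)
  then obtain c :: "'a + 'a set \<Rightarrow> nat" where c: "inj_on c (objects V E)"
    using finite_imp_inj_to_nat_seg by blast
  have irrefl: "\<not> adj_or_inc E x x" if "x \<in> objects V E" for x
    using G by (cases x) (auto simp: simple_graph_def)
  have nbr: "\<exists>y\<in>objects V E. adj_or_inc E x y" if x: "x \<in> objects V E" for x
  proof (cases x)
    case (Inl v)
    then have v: "v \<in> V" using x by (auto simp: objects_def)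
    have "Min (degree E ` V) \<le> degree E v" using v finV by simp
    then have "degree E v > 0" using pos by (simp add: min_degree_def)
    then have "{e \<in> E. v \<in> e} \<noteq> {}" unfolding degree_def by (metis card.empty less_irrefl)
    then obtain e where "e \<in> E" "v \<in> e" by blast
    then show ?thesis using Inl by (intro bexI[of _ "Inr e"]) (auto simp: objects_def)
  next
    case (Inr e)
    then have e: "e \<in> E" using x by (auto simp: objects_def)
    then have "e \<subseteq> V" "card e = 2" using G by (auto simp: simple_graph_def)
    then have "e \<noteq> {}" by auto
    then obtain v where "v \<in> e" "v \<in> V" using \<open>e \<subseteq> V\<close> by blast
    then show ?thesis using Inr by (intro bexI[of _ "Inl v"]) (auto simp: objects_def)
  qed
  have "total_coloring V E c"
    using c irrefl unfolding total_coloring_def inj_on_def by metis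
  moreover have "\<exists>C\<in>color_classes V E c. \<forall>y\<in>C. adj_or_inc E x y" if x: "x \<in> objects V E" for x
  proof -
    obtain y where y: "y \<in> objects V E" "adj_or_inc E x y" using nbr[OF x] by blast
    have "{z \<in> objects V E. c z = c y} = {y}" using c y by (auto simp: inj_on_def)
    then have "{y} \<in> color_classes V E c" using y unfolding color_classes_def by blast
    then show ?thesis using y by blast
  qed
  ultimately show ?thesis unfolding total_dominator_total_coloring_def by blast
qed

end

(*
  The star K_{1,n-1} works. Its centre and its n - 1 edges are pairwise adjacent or incident,
  so every total coloring needs n colors. Conversely, color the centre and the edges with n distinct
  colors and every leaf with the color of an edge not incident to it. The centre then forms a color
  class on its own, which every other object dominates, and the centre itself is adjacent or
  incident to every other object, hence dominates every other color class.
*)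
theory Submission
  imports Defs
begin

text \<open>Classes of different used colors differ because each is nonempty, so counting classes
  amounts to counting used colors.\<close>

lemma card_color_classes: "card (color_classes V E c) = card (c ` objects V E)"
  unfolding color_classes_def by (rule card_image) (auto simp: inj_on_def)

lemma card_clique_le_card_color_classes:
  assumes "total_coloring V E c" and "finite (objects V E)" and "K \<subseteq> objects V E"
    and "\<And>x y. x \<in> K \<Longrightarrow> y \<in> K \<Longrightarrow> x \<noteq> y \<Longrightarrow> adj_or_inc E x y"
  shows "card K \<le> card (color_classes V E c)"
proof -
  have "inj_on c K"
    using assms unfolding total_coloring_def inj_on_def by (metis subsetD)
  then have "card K = card (c ` K)" by (simp add: card_image)
  also have "\<dots> \<le> card (c ` objects V E)"
    using assms by (intro card_mono finite_imageI image_mono)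
  finally show ?thesis by (simp add: card_color_classes)
qed

lemma tdt_chromatic_number_eqI:
  assumes "total_dominator_total_coloring V E c" and "card (color_classes V E c) = k"
    and "\<And>d. total_dominator_total_coloring V E d \<Longrightarrow> k \<le> card (color_classes V E d)"
  shows "tdt_chromatic_number V E = k"
  unfolding tdt_chromatic_number_def using assms by (intro Least_equality) auto

text \<open>The centre is 0, so the leaf of an edge is its maximum; \<open>star_coloring\<close>
  relies on this.\<close>

definition star_edges :: "nat \<Rightarrow> nat set set" where
  "star_edges n = (\<lambda>i. {0, i}) ` {1..<n}"

lemma simple_graph_star: "simple_graph {..<n} (star_edges n)"
  by (auto simp: simple_graph_def star_edges_def)

lemma finite_objects_star: "finite (objects {..<n} (star_edges n))"
  by (simp add: objects_def star_edges_def)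

lemma star_objects_cases:
  assumes "x \<in> objects {..<n} (star_edges n)"
  obtains "x = Inl 0"
  | i where "1 \<le> i" "i < n" "x = Inl i"
  | i where "1 \<le> i" "i < n" "x = Inr {0, i}"
proof (cases x)
  case (Inl v)
  then show ?thesis using assms that by (cases "v = 0") (auto simp: objects_def)
next
  case (Inr e)
  then show ?thesis using assms that by (auto simp: objects_def star_edges_def)
qed

lemma doubleton_in_star_edges [simp]:
  "{u, v} \<in> star_edges n \<longleftrightarrow> (u = 0 \<and> 1 \<le> v \<and> v < n) \<or> (v = 0 \<and> 1 \<le> u \<and> u < n)"
  by (auto simp: star_edges_def doubleton_eq_iff)

text \<open>The simplifier merges \<open>{u, u}\<close> into \<open>{u}\<close>, which the preceding
  rule does not match; this covers a vertex compared with itself.\<close>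

lemma singleton_notin_star_edges [simp]: "{u} \<notin> star_edges n"
  using doubleton_in_star_edges[of u u n] by (simp del: doubleton_in_star_edges)

lemma min_degree_star:
  assumes "n \<ge> 2"
  shows "min_degree {..<n} (star_edges n) > 0"
proof -
  have "degree (star_edges n) v > 0" if "v < n" for v
  proof -
    \<comment> \<open>A leaf lies on its own edge; for the centre the edge to leaf 1 is chosen,
      which exists since n \<ge> 2.\<close>
    have "{0, if v = 0 then 1 else v} \<in> {e \<in> star_edges n. v \<in> e}"
      using assms that by auto
    moreover have "finite {e \<in> star_edges n. v \<in> e}" by (simp add: star_edges_def)
    ultimately show ?thesis unfolding degree_def card_gt_0_iff by blast
  qed
  moreover have "0 \<in> {..<n}" using assms by simp
  then have "{..<n} \<noteq> {}" by blast
  ultimately show ?thesis by (simp add: min_degree_def)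
qed

lemma star_color_classes_ge:
  assumes "n \<ge> 1" and "total_coloring {..<n} (star_edges n) c"
  shows "n \<le> card (color_classes {..<n} (star_edges n) c)"
proof -
  let ?K = "insert (Inl 0) (Inr ` star_edges n) :: (nat + nat set) set"
  have "inj_on (\<lambda>i::nat. {0, i}) {1..<n}" by (auto simp: inj_on_def doubleton_eq_iff)
  then have "card (star_edges n) = n - 1" by (simp add: star_edges_def card_image)
  moreover have "finite (star_edges n)" by (simp add: star_edges_def)
  \<comment> \<open>The centre adds 1 to the truncated difference \<open>n - 1\<close>, which
    restores n because n \<ge> 1.\<close>
  ultimately have "card ?K = n" using assms by (simp add: card_insert_if card_image image_iff)
  moreover have "card ?K \<le> card (color_classes {..<n} (star_edges n) c)"
  proof (rule card_clique_le_card_color_classes[OF assms(2) finite_objects_star])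
    show "?K \<subseteq> objects {..<n} (star_edges n)" using assms(1) by (auto simp: objects_def)
    \<comment> \<open>The centre is incident to every edge and is a common endpoint of any two, so
      \<open>?K\<close> is a clique.\<close>
    have "0 \<in> e" if "e \<in> star_edges n" for e using that by (auto simp: star_edges_def)
    then show "adj_or_inc (star_edges n) x y" if "x \<in> ?K" "y \<in> ?K" "x \<noteq> y" for x y
      using that by (cases x; cases y; simp; blast)
  qed
  ultimately show ?thesis by simp
qed

text \<open>The edge to leaf i gets color i. Leaves reuse color 1, except leaf 1, whose own edge has
  that color; it takes 2, the color of another edge once n \<ge> 3.\<close>

fun star_coloring :: "nat + nat set \<Rightarrow> nat" where
  "star_coloring (Inl v) = (if v = 0 then 0 else if v = 1 then 2 else 1)"
| "star_coloring (Inr e) = Max e"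

lemma star_coloring_image:
  assumes "n \<ge> 3"
  shows "star_coloring ` objects {..<n} (star_edges n) = {..<n}"
proof
  show "star_coloring ` objects {..<n} (star_edges n) \<subseteq> {..<n}"
    using assms by (auto elim!: star_objects_cases)
  show "{..<n} \<subseteq> star_coloring ` objects {..<n} (star_edges n)"
  proof
    fix i assume i: "i \<in> {..<n}"
    \<comment> \<open>The centre and the edges alone already realize every color below n.\<close>
    let ?x = "if i = 0 then Inl 0 else Inr {0, i}"
    have "?x \<in> objects {..<n} (star_edges n)" using i by (auto simp: objects_def)
    moreover have "star_coloring ?x = i" by simp
    ultimately show "i \<in> star_coloring ` objects {..<n} (star_edges n)" by (metis (full_types) imageI)
  qed
qed

lemma total_dominator_star_coloring:
  assumes "n \<ge> 3"
  shows "total_dominator_total_coloring {..<n} (star_edges n) star_coloring"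
proof -
  let ?O = "objects {..<n} (star_edges n)"
  have "total_coloring {..<n} (star_edges n) star_coloring"
    unfolding total_coloring_def
    by (auto elim!: star_objects_cases split: if_split_asm)
  moreover have "\<exists>C\<in>color_classes {..<n} (star_edges n) star_coloring.
      \<forall>y\<in>C. adj_or_inc (star_edges n) x y" if x: "x \<in> ?O" for x
  proof -
    \<comment> \<open>Color 0 occurs only at the centre, which is related to every other object. The
      centre itself needs a class avoiding it: color 1 consists of the edge to leaf 1 and the leaves
      from 2 on.\<close>
    define k :: nat where "k = (if x = Inl 0 then 1 else 0)"
    have "k \<in> star_coloring ` ?O"
      unfolding star_coloring_image[OF assms] using assms by (simp add: k_def)
    then have "{y \<in> ?O. star_coloring y = k} \<in> color_classes {..<n} (star_edges n) star_coloring"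
      unfolding color_classes_def by blast
    moreover have "adj_or_inc (star_edges n) x y" if "y \<in> ?O" "star_coloring y = k" for y
      using x that by (auto simp: k_def elim!: star_objects_cases split: if_splits)
    ultimately show ?thesis by (intro bexI[of _ "{y \<in> ?O. star_coloring y = k}"]) simp_all
  qed
  ultimately show ?thesis unfolding total_dominator_total_coloring_def by (intro conjI ballI)
qed

theorem theorem3p2:
  fixes n :: nat
  assumes "n \<ge> 3"
  shows "\<exists>(V :: nat set) E. simple_graph V E \<and> card V = n \<and> min_degree V E > 0
           \<and> tdt_chromatic_number V E = n"
proof (intro exI conjI)
  show "simple_graph {..<n} (star_edges n)" by (rule simple_graph_star)
  show "card {..<n} = n" by simp
  show "min_degree {..<n} (star_edges n) > 0" using assms by (simp add: min_degree_star)
  show "tdt_chromatic_number {..<n} (star_edges n) = n"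
  proof (rule tdt_chromatic_number_eqI)
    show "total_dominator_total_coloring {..<n} (star_edges n) star_coloring"
      using assms by (rule total_dominator_star_coloring)
    show "card (color_classes {..<n} (star_edges n) star_coloring) = n"
      using assms by (simp add: card_color_classes star_coloring_image)
    show "n \<le> card (color_classes {..<n} (star_edges n) d)"
      if "total_dominator_total_coloring {..<n} (star_edges n) d" for d
      using assms that
      by (intro star_color_classes_ge) (auto simp: total_dominator_total_coloring_def)
  qed
qed

end
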